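(* The hybridizable discontinuous Galerkin (HDG) method and the primal weak Galerkin finite element method (primal WG-FEM), both taken with the same finite element spaces and the same stabilization parameters, are not equivalent for the general model problem $-\nabla\cdot(a\nabla u)=f$ in $\Omega$, $u=0$ on $\partial\Omega$. That is, it is not true that for every admissible choice of the domain $\Omega$, the coefficient $a$, the partitions $\mathcal{T}_h,\mathcal{E}_h$, the integers $k\ge 1$, $s\ge 0$, $r\ge 0$ and the parameter $\rho>0$ the two methods have the same solution for every $f\in L^2(\Omega)$. Equivalently, there exist such $\Omega$, $a$, $\mathcal{T}_h$, $\mathcal{E}_h$, $k,s,r,\rho$ and some $f\in L^2(\Omega)$ for which the set of pairs $(u_h,\hat u_h)$ arising from solutions of the HDG method differs from the set of pairs $(u_0,u_b)$ solving the primal WG-FEM.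
   Context: **Model problem.** $\Omega\subset\mathbb{R}^d$ ($d=2,3$) is a bounded polygonal or polyhedral domain; $a=a(\mathbf{x})$ is a $d\times d$ coefficient tensor on $\Omega$ that is bounded, piecewise continuous, and uniformly symmetric and positive definite (a scalar function $a$ is identified with $a$ times the identity). Put $c=a^{-1}$. $(\cdot,\cdot)$ is the $L^2(\Omega)$ inner product, $(\cdot,\cdot)_T$ the $L^2(T)$ inner product, and $\langle\cdot,\cdot\rangle_{\partial T}$ the $L^2(\partial T)$ inner product. **Partitions.** $\mathcal{T}_h$ is a finite partition of $\Omega$ into polygons/polyhedra $T$, with diameter $h_T$ and unit outward normal $\mathbf{n}_T$ (or $\mathbf n$) on $\partial T$. $\mathcal{E}_h$ is a partition of the union of all element boundaries into flat $(d-1)$-dimensional pieces $e$, such that each $\partial T$, and each $(d-1)$-dimensional interface $\partial T_1\cap\partial T_2$, is a union of members of $\mathcal{E}_h$. $P_j(D)$ denotes polynomials of degree at most $j$ on $D$. **Common spaces.** $\mathbf{V}_h=\{\mathbf{v}\in[L^2(\Omega)]^d:\ \mathbf{v}|_T\in[P_r(T)]^d\ \forall T\in\mathcal{T}_h\}$; $W_h=\{w\in L^2(\Omega):\ w|_T\in P_k(T)\ \forall T\in\mathcal{T}_h\}$; $M_h$ is the space of (single-valued) functions $\mu$ on the union of the members of $\mathcal{E}_h$ with $\mu|_e\in P_s(e)$ for all $e\in\mathcal{E}_h$; $M_h^0=\{\mu\in M_h:\ \mu|_{\partial\Omega}=0\}$. The weak finite element space is $W_h^0=\{w=\{w_0,w_b\}:\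 w_0\in W_h,\ w_b\in M_h^0\}$. The common stabilization parameter is $\tau|_{\partial T}=\rho h_T^{-1}$. **HDG method.** Find $(\tilde{\mathbf{q}}_h,u_h,\hat u_h)\in\mathbf{V}_h\times W_h\times M_h$ such that for all $(\mathbf{v},w,\mu)\in\mathbf{V}_h\times W_h\times M_h$ $$\sum_T\big[(c\tilde{\mathbf{q}}_h,\mathbf{v})_T-(u_h,\nabla\cdot\mathbf{v})_T+\langle\hat u_h,\mathbf{v}\cdot\mathbf{n}\rangle_{\partial T}\big]=0,$$ $$\sum_T\big[-(\tilde{\mathbf{q}}_h,\nabla w)_T+\langle\hat{\mathbf{q}}_h\cdot\mathbf{n},w\rangle_{\partial T}\big]=(f,w),$$ $$\sum_T\langle\hat{\mathbf{q}}_h\cdot\mathbf{n},\mu\rangle_{\partial T\setminus\partial\Omega}=0,\qquad \langle\hat u_h,\mu\rangle_{\partial\Omega}=0,$$ where $\hat{\mathbf{q}}_h\cdot\mathbf{n}=\tilde{\mathbf{q}}_h\cdot\mathbf{n}+\tau(u_h-\hat u_h)$ on $\partial T$ for each $T\in\mathcal{T}_h$. **Primal WG-FEM.** For $w=\{w_0,w_b\}\in W_h^0$, the discrete weak gradient $\nabla_w w\in\mathbf{V}_h$ is defined on each $T$ by $$(\nabla_w w,\mathbf{v})_T=-(w_0,\nabla\cdot\mathbf{v})_T+\langle w_b,\mathbf{v}\cdot\mathbf{n}_T\rangle_{\partial T}\qquad\forall\mathbf{v}\in[P_r(T)]^d.$$ Let $Q_b$ be the $L^2$ projection, on each $e\in\mathcal{E}_h$,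 onto $P_s(e)$, and $$s_p(w,\phi)=\rho\sum_{T\in\mathcal{T}_h}h_T^{-1}\langle Q_bw_0-w_b,\,Q_b\phi_0-\phi_b\rangle_{\partial T}.$$ The primal WG-FEM is: find $\{u_0,u_b\}\in W_h^0$ such that, writing $U_h=\{u_0,u_b\}$, $$(a\nabla_wU_h,\nabla_wv)+s_p(U_h,v)=(f,v_0)\qquad\forall v=\{v_0,v_b\}\in W_h^0.$$ **Equivalence.** The two methods are called equivalent if they have the same solution for any given $f$, with $(u_h,\hat u_h)$ identified with $(u_0,u_b)$. *)

theory Defs
  imports "HOL-Analysis.Analysis"
begin

section \<open>Polygonal and polyhedral sets\<close>

text \<open>A (possibly nonconvex) relatively open polytopal set of dimension \<open>m\<close>. The closure is a finite
  union of convex polytopes; equality with the relative interior of the closure excludes slits.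
  In \<open>\<real>\<^sup>d\<close>, the case \<open>m = d\<close> gives (open) polygons and polyhedra, and \<open>m = d - 1\<close> gives flat pieces,
  each contained in one hyperplane.\<close>

definition open_polytopal :: "int \<Rightarrow> 'a::euclidean_space set \<Rightarrow> bool" where
  "open_polytopal m S \<longleftrightarrow>
     S \<noteq> {} \<and> connected S \<and> aff_dim S = m \<and> rel_interior (closure S) = S \<and>
     (\<exists>P. finite P \<and> (\<forall>p\<in>P. polytope p) \<and> closure S = \<Union>P)"

definition polytopal_domain :: "'a::euclidean_space set \<Rightarrow> bool" where
  "polytopal_domain \<Omega> \<longleftrightarrow> open_polytopal (int DIM('a)) \<Omega>"

text \<open>Elements are open, so that they are disjoint; they cover \<open>\<Omega>\<close> up to their boundaries.\<close>

definition polytopal_partition :: "'a::euclidean_space set \<Rightarrow> 'a set set \<Rightarrow> bool" where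
  "polytopal_partition \<Omega> Th \<longleftrightarrow>
     finite Th \<and> (\<forall>T\<in>Th. polytopal_domain T) \<and> pairwise disjnt Th \<and>
     \<Union>Th \<subseteq> \<Omega> \<and> closure \<Omega> = \<Union>(closure ` Th)"

text \<open>The members of \<open>E\<close> that make up the boundary of \<open>D\<close>.\<close>

definition faces :: "'a::euclidean_space set set \<Rightarrow> 'a set \<Rightarrow> 'a set set" where
  "faces E D = {e\<in>E. e \<subseteq> frontier D}"

text \<open>The flat pieces are relatively open, so that functions on their union are single-valued on each
  interface but need not be continuous where pieces meet. An element boundary is a union of members
  in the sense of closures. In the last clause, the \<open>(d-1)\<close>-dimensional part of an interface is
  the part covered by flat \<open>(d-1)\<close>-dimensional pieces; two elements may in addition touch in a set of
  lower dimension.\<close>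

definition face_partition :: "'a::euclidean_space set set \<Rightarrow> 'a set set \<Rightarrow> bool" where
  "face_partition Th E \<longleftrightarrow>
     finite E \<and> (\<forall>e\<in>E. open_polytopal (int DIM('a) - 1) e) \<and> pairwise disjnt E \<and>
     \<Union>(frontier ` Th) = \<Union>(closure ` E) \<and>
     (\<forall>T\<in>Th. frontier T = \<Union>(closure ` faces E T)) \<and>
     (\<forall>T1\<in>Th. \<forall>T2\<in>Th. T1 \<noteq> T2 \<longrightarrow>
        (\<forall>g. open_polytopal (int DIM('a) - 1) g \<and> g \<subseteq> frontier T1 \<inter> frontier T2 \<longrightarrow>
             g \<subseteq> \<Union>(closure ` (faces E T1 \<inter> faces E T2))))"

text \<open>\<open>\<nu>\<close> is the outward normal at \<open>x\<close> if near \<open>x\<close> the set is the half-space below the hyperplane through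
  \<open>x\<close> orthogonal to \<open>\<nu>\<close>; such a \<open>\<nu>\<close> is unique, and exists at almost every boundary point of an element.\<close>

definition outward_normal :: "'a::euclidean_space set \<Rightarrow> 'a \<Rightarrow> 'a" where
  "outward_normal T x =
     (THE \<nu>. norm \<nu> = 1 \<and> (\<exists>\<epsilon>>0. \<forall>y\<in>ball x \<epsilon>. y \<in> T \<longleftrightarrow> (y - x) \<bullet> \<nu> < 0))"

section \<open>Inner products\<close>

definition L2_inner :: "'a::euclidean_space set \<Rightarrow> ('a \<Rightarrow> 'b::euclidean_space) \<Rightarrow> ('a \<Rightarrow> 'b) \<Rightarrow> real" where
  "L2_inner D f g = (LINT x|lebesgue_on D. f x \<bullet> g x)"

definition L2_fun :: "'a::euclidean_space set \<Rightarrow> ('a \<Rightarrow> real) \<Rightarrow> bool" where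
  "L2_fun D f \<longleftrightarrow>
     f \<in> borel_measurable (lebesgue_on D) \<and> integrable (lebesgue_on D) (\<lambda>x. (f x)\<^sup>2)"

text \<open>The \<open>(d-1)\<close>-dimensional Lebesgue measure on the hyperplane spanned by a flat piece \<open>e\<close>: the
  measure of a subset \<open>A\<close> of the hyperplane is the volume of the right cylinder of height 1 with \<open>A\<close> as
  its mid-section (\<open>closest_point\<close> is the orthogonal projection onto the hyperplane).\<close>

definition hyperplane_measure :: "'a::euclidean_space set \<Rightarrow> 'a measure" where
  "hyperplane_measure e =
     distr (restrict_space lborel {z. infdist z (affine hull e) \<le> 1/2}) borel
           (closest_point (affine hull e))"

definition face_inner :: "'a::euclidean_space set \<Rightarrow> ('a \<Rightarrow> real) \<Rightarrow> ('a \<Rightarrow> real) \<Rightarrow> real" where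
  "face_inner e f g = (LINT x:e|hyperplane_measure e. f x * g x)"

text \<open>The inner product over a union of flat pieces; \<open>faces_inner (faces E T)\<close> is the one over
  \<open>\<partial>T\<close>.\<close>

definition faces_inner :: "'a::euclidean_space set set \<Rightarrow> ('a \<Rightarrow> real) \<Rightarrow> ('a \<Rightarrow> real) \<Rightarrow> real" where
  "faces_inner F f g = (\<Sum>e\<in>F. face_inner e f g)"

section \<open>Piecewise polynomial spaces\<close>

definition poly_fun :: "nat \<Rightarrow> (real^'n \<Rightarrow> real) set" where
  "poly_fun j =
     {p. \<exists>c :: ('n \<Rightarrow> nat) \<Rightarrow> real.
           \<forall>x. p x = (\<Sum>\<alpha> | (\<Sum>i\<in>UNIV. \<alpha> i) \<le> j. c \<alpha> * (\<Prod>i\<in>UNIV. (x $ i) ^ \<alpha> i))}"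

text \<open>Functions on \<open>\<Union>S\<close> that are polynomial on each member of the disjoint family \<open>S\<close>. Functions on
  \<open>\<Union>S\<close> are represented as total functions vanishing elsewhere, which makes equality of functions
  the same as equality almost everywhere on \<open>\<Union>S\<close>. In particular \<open>pw_poly j {D}\<close> is \<open>P\<^sub>j(D)\<close>.\<close>

definition pw_poly :: "nat \<Rightarrow> (real^'n) set set \<Rightarrow> (real^'n \<Rightarrow> real) set" where
  "pw_poly j S =
     {w. (\<forall>D\<in>S. \<exists>p\<in>poly_fun j. \<forall>x\<in>D. w x = p x) \<and> (\<forall>x. x \<notin> \<Union>S \<longrightarrow> w x = 0)}"

definition pw_poly_vec :: "nat \<Rightarrow> (real^'n) set set \<Rightarrow> (real^'n \<Rightarrow> real^'n) set" where
  "pw_poly_vec j S = {v. \<forall>i. (\<lambda>x. v x $ i) \<in> pw_poly j S}"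

abbreviation V_h :: "(real^'n) set set \<Rightarrow> nat \<Rightarrow> (real^'n \<Rightarrow> real^'n) set" where
  "V_h Th r \<equiv> pw_poly_vec r Th"

abbreviation W_h :: "(real^'n) set set \<Rightarrow> nat \<Rightarrow> (real^'n \<Rightarrow> real) set" where
  "W_h Th k \<equiv> pw_poly k Th"

abbreviation M_h :: "(real^'n) set set \<Rightarrow> nat \<Rightarrow> (real^'n \<Rightarrow> real) set" where
  "M_h E s \<equiv> pw_poly s E"

definition M_h0 :: "(real^'n) set \<Rightarrow> (real^'n) set set \<Rightarrow> nat \<Rightarrow> (real^'n \<Rightarrow> real) set" where
  "M_h0 \<Omega> E s = {\<mu> \<in> M_h E s. \<forall>e\<in>faces E \<Omega>. \<forall>x\<in>e. \<mu> x = 0}"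

text \<open>The value on \<open>\<partial>T\<close>, taken from inside \<open>T\<close>, of a function that may jump across \<open>\<partial>T\<close>.\<close>

definition trace_from :: "'a::euclidean_space set \<Rightarrow> ('a \<Rightarrow> 'b::euclidean_space) \<Rightarrow> 'a \<Rightarrow> 'b" where
  "trace_from T w x = Lim (at x within T) w"

definition grad :: "(real^'n \<Rightarrow> real) \<Rightarrow> real^'n \<Rightarrow> real^'n" where
  "grad w x = (\<chi> i. frechet_derivative w (at x) (axis i 1))"

definition divergence :: "(real^'n \<Rightarrow> real^'n) \<Rightarrow> real^'n \<Rightarrow> real" where
  "divergence v x = (\<Sum>i\<in>UNIV. frechet_derivative v (at x) (axis i 1) $ i)"

section \<open>The data of the problem\<close>

definition coefficient :: "(real^'n) set \<Rightarrow> (real^'n \<Rightarrow> real^'n^'n) \<Rightarrow> bool" where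
  "coefficient \<Omega> a \<longleftrightarrow>
     bounded (a ` \<Omega>) \<and>
     (\<exists>P. polytopal_partition \<Omega> P \<and> (\<forall>D\<in>P. continuous_on D a)) \<and>
     (\<forall>x\<in>\<Omega>. transpose (a x) = a x) \<and>
     (\<exists>\<alpha>>0. \<forall>x\<in>\<Omega>. \<forall>\<xi>. \<alpha> * (norm \<xi>)\<^sup>2 \<le> \<xi> \<bullet> (a x *v \<xi>))"

definition admissible ::
  "(real^'n) set \<Rightarrow> (real^'n \<Rightarrow> real^'n^'n) \<Rightarrow> (real^'n) set set \<Rightarrow> (real^'n) set set \<Rightarrow> nat \<Rightarrow> real \<Rightarrow> bool" where
  "admissible \<Omega> a Th E k \<rho> \<longleftrightarrow>
     polytopal_domain \<Omega> \<and> coefficient \<Omega> a \<and> polytopal_partition \<Omega> Th \<and> face_partition Th E \<and>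
     1 \<le> k \<and> 0 < \<rho>"

section \<open>The HDG method\<close>

definition num_flux ::
  "real \<Rightarrow> (real^'n \<Rightarrow> real^'n) \<Rightarrow> (real^'n \<Rightarrow> real) \<Rightarrow> (real^'n \<Rightarrow> real) \<Rightarrow> (real^'n) set \<Rightarrow> real^'n \<Rightarrow> real" where
  "num_flux \<rho> q u uhat T x =
     trace_from T q x \<bullet> outward_normal T x + \<rho> / diameter T * (trace_from T u x - uhat x)"

definition hdg_solves ::
  "(real^'n) set \<Rightarrow> (real^'n \<Rightarrow> real^'n^'n) \<Rightarrow> (real^'n) set set \<Rightarrow> (real^'n) set set \<Rightarrow>
   nat \<Rightarrow> nat \<Rightarrow> nat \<Rightarrow> real \<Rightarrow> (real^'n \<Rightarrow> real) \<Rightarrow>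
   (real^'n \<Rightarrow> real^'n) \<Rightarrow> (real^'n \<Rightarrow> real) \<Rightarrow> (real^'n \<Rightarrow> real) \<Rightarrow> bool" where
  "hdg_solves \<Omega> a Th E k s r \<rho> f q u uhat \<longleftrightarrow>
     q \<in> V_h Th r \<and> u \<in> W_h Th k \<and> uhat \<in> M_h E s \<and>
     (\<forall>v\<in>V_h Th r.
        (\<Sum>T\<in>Th. L2_inner T (\<lambda>x. matrix_inv (a x) *v q x) v - L2_inner T u (divergence v)
          + faces_inner (faces E T) uhat (\<lambda>x. trace_from T v x \<bullet> outward_normal T x)) = 0) \<and>
     (\<forall>w\<in>W_h Th k.
        (\<Sum>T\<in>Th. - L2_inner T q (grad w)
          + faces_inner (faces E T) (num_flux \<rho> q u uhat T) (trace_from T w)) = L2_inner \<Omega> f w) \<and>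
     (\<forall>\<mu>\<in>M_h E s.
        (\<Sum>T\<in>Th. faces_inner (faces E T - faces E \<Omega>) (num_flux \<rho> q u uhat T) \<mu>) = 0 \<and>
        faces_inner (faces E \<Omega>) uhat \<mu> = 0)"

definition hdg_solutions ::
  "(real^'n) set \<Rightarrow> (real^'n \<Rightarrow> real^'n^'n) \<Rightarrow> (real^'n) set set \<Rightarrow> (real^'n) set set \<Rightarrow>
   nat \<Rightarrow> nat \<Rightarrow> nat \<Rightarrow> real \<Rightarrow> (real^'n \<Rightarrow> real) \<Rightarrow> ((real^'n \<Rightarrow> real) \<times> (real^'n \<Rightarrow> real)) set" where
  "hdg_solutions \<Omega> a Th E k s r \<rho> f = {(u, uhat). \<exists>q. hdg_solves \<Omega> a Th E k s r \<rho> f q u uhat}"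

section \<open>The primal weak Galerkin method\<close>

definition W_h0 ::
  "(real^'n) set \<Rightarrow> (real^'n) set set \<Rightarrow> (real^'n) set set \<Rightarrow> nat \<Rightarrow> nat \<Rightarrow>
   ((real^'n \<Rightarrow> real) \<times> (real^'n \<Rightarrow> real)) set" where
  "W_h0 \<Omega> Th E k s = W_h Th k \<times> M_h0 \<Omega> E s"

definition weak_grad ::
  "(real^'n) set set \<Rightarrow> (real^'n) set set \<Rightarrow> nat \<Rightarrow>
   (real^'n \<Rightarrow> real) \<times> (real^'n \<Rightarrow> real) \<Rightarrow> real^'n \<Rightarrow> real^'n" where
  "weak_grad Th E r w =
     (THE g. g \<in> V_h Th r \<and>
        (\<forall>T\<in>Th. \<forall>v\<in>pw_poly_vec r {T}.
           L2_inner T g v =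
             - L2_inner T (fst w) (divergence v)
             + faces_inner (faces E T) (snd w) (\<lambda>x. trace_from T v x \<bullet> outward_normal T x)))"

definition face_proj :: "nat \<Rightarrow> (real^'n) set \<Rightarrow> (real^'n \<Rightarrow> real) \<Rightarrow> real^'n \<Rightarrow> real" where
  "face_proj s e g =
     (THE \<mu>. \<mu> \<in> pw_poly s {e} \<and> (\<forall>p\<in>pw_poly s {e}. face_inner e (\<lambda>x. \<mu> x - g x) p = 0))"

text \<open>Each \<open>face_proj s e g\<close> vanishes off \<open>e\<close>, so the sum below equals \<open>face_proj s e g\<close> on \<open>e\<close>.\<close>

definition Q_b :: "(real^'n) set set \<Rightarrow> nat \<Rightarrow> (real^'n \<Rightarrow> real) \<Rightarrow> real^'n \<Rightarrow> real" where
  "Q_b E s g x = (\<Sum>e\<in>E. face_proj s e g x)"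

definition s_p ::
  "(real^'n) set set \<Rightarrow> (real^'n) set set \<Rightarrow> nat \<Rightarrow> real \<Rightarrow>
   (real^'n \<Rightarrow> real) \<times> (real^'n \<Rightarrow> real) \<Rightarrow> (real^'n \<Rightarrow> real) \<times> (real^'n \<Rightarrow> real) \<Rightarrow> real" where
  "s_p Th E s \<rho> w \<phi> =
     \<rho> * (\<Sum>T\<in>Th. 1 / diameter T *
            faces_inner (faces E T)
              (\<lambda>x. Q_b E s (trace_from T (fst w)) x - snd w x)
              (\<lambda>x. Q_b E s (trace_from T (fst \<phi>)) x - snd \<phi> x))"

definition wg_solutions ::
  "(real^'n) set \<Rightarrow> (real^'n \<Rightarrow> real^'n^'n) \<Rightarrow> (real^'n) set set \<Rightarrow> (real^'n) set set \<Rightarrow>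
   nat \<Rightarrow> nat \<Rightarrow> nat \<Rightarrow> real \<Rightarrow> (real^'n \<Rightarrow> real) \<Rightarrow> ((real^'n \<Rightarrow> real) \<times> (real^'n \<Rightarrow> real)) set" where
  "wg_solutions \<Omega> a Th E k s r \<rho> f =
     {U \<in> W_h0 \<Omega> Th E k s. \<forall>v\<in>W_h0 \<Omega> Th E k s.
        L2_inner \<Omega> (\<lambda>x. a x *v weak_grad Th E r U x) (weak_grad Th E r v) + s_p Th E s \<rho> U v
          = L2_inner \<Omega> f (fst v)}"

section \<open>Equivalence\<close>

definition methods_equivalent ::
  "(real^'n) set \<Rightarrow> (real^'n \<Rightarrow> real^'n^'n) \<Rightarrow> (real^'n) set set \<Rightarrow> (real^'n) set set \<Rightarrow>
   nat \<Rightarrow> nat \<Rightarrow> nat \<Rightarrow> real \<Rightarrow> bool" where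
  "methods_equivalent \<Omega> a Th E k s r \<rho> \<longleftrightarrow>
     (\<forall>f. L2_fun \<Omega> f \<longrightarrow> hdg_solutions \<Omega> a Th E k s r \<rho> f = wg_solutions \<Omega> a Th E k s r \<rho> f)"

end

theory Submission
  imports Defs
begin

text \<open>On the one-element partition of a cube take the identity coefficient, \<open>k = 2\<close>, \<open>r = s = 0\<close> and
  \<open>f = 0\<close>. For \<open>p \<noteq> q\<close> the function \<open>x\<^sub>p x\<^sub>q\<close> is odd under a reflection preserving any given side, so
  it has mean zero on every side. Its projection \<open>Q\<^sub>b\<close> therefore vanishes, and so does the weak
  gradient of the pair \<open>{x\<^sub>p x\<^sub>q, 0}\<close>: the pair solves the weak Galerkin problem with zero data. The
  HDG stabilization contains no projection; there the flux unknown of such a solution is zero,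
  and testing with \<open>x\<^sub>p x\<^sub>q\<close> leaves \<open>\<rho> / h\<^sub>T\<close> times the integral of \<open>(x\<^sub>p x\<^sub>q)\<^sup>2\<close> over the boundary, which is
  positive.\<close>

section \<open>The cube and its sides\<close>

text \<open>Centred at the origin, so that changing the sign of a coordinate other than the
  \<open>i\<close>-th maps each \<open>side i c\<close> to itself.\<close>

definition cube :: "(real^'n) set" where
  "cube = box (- 1) 1"

definition coord_plane :: "'n \<Rightarrow> real \<Rightarrow> (real^'n) set" where
  "coord_plane i c = {x. x $ i = c}"

text \<open>Relatively open: leaving out the lower-dimensional edges makes distinct sides of the
  cube disjoint.\<close>

definition side :: "'n \<Rightarrow> real \<Rightarrow> (real^'n) set" where
  "side i c = {x \<in> coord_plane i c. \<forall>j. j \<noteq> i \<longrightarrow> \<bar>x $ j\<bar> < 1}"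

definition cube_sides :: "(real^'n) set set" where
  "cube_sides = (\<lambda>(i, c). side i c) ` (UNIV \<times> {- 1, 1})"

definition coord_proj :: "'n \<Rightarrow> real \<Rightarrow> real^'n \<Rightarrow> real^'n" where
  "coord_proj i c z = (\<chi> j. if j = i then c else z $ j)"

lemma mem_cube: "x \<in> (cube :: (real^'n) set) \<longleftrightarrow> (\<forall>j. \<bar>x $ j\<bar> < 1)"
  by (auto simp: cube_def mem_box_cart abs_less_iff minus_less_iff)

lemma open_cube: "open cube"
  by (simp add: cube_def open_box)

lemma zero_in_cube: "0 \<in> cube"
  by (simp add: mem_cube)

lemma closure_cube: "closure cube = (cbox (- 1) 1 :: (real^'n) set)"
  using zero_in_cube unfolding cube_def by (intro closure_box) auto

lemma mem_closure_cube: "x \<in> closure (cube :: (real^'n) set) \<longleftrightarrow> (\<forall>j. \<bar>x $ j\<bar> \<le> 1)"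
  by (auto simp: closure_cube mem_box_cart abs_le_iff minus_le_iff)

lemma frontier_cube: "frontier cube = closure cube - (cube :: (real^'n) set)"
  by (simp add: frontier_def interior_open open_cube)

lemma polytopal_domain_cube: "polytopal_domain (cube :: (real^'n) set)"
  unfolding polytopal_domain_def open_polytopal_def
proof (intro conjI exI)
  show "cube \<noteq> ({} :: (real^'n) set)"
    using zero_in_cube by auto
  show "connected (cube :: (real^'n) set)"
    by (simp add: cube_def convex_connected)
  show "aff_dim (cube :: (real^'n) set) = int DIM(real^'n)"
    using zero_in_cube by (intro aff_dim_open open_cube) auto
  show "rel_interior (closure cube) = (cube :: (real^'n) set)"
    by (metis convex_rel_interior_closure rel_interior_open open_cube cube_def convex_box(2))
  show "\<forall>p\<in>{closure cube :: (real^'n) set}. polytope p"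
    by (simp add: closure_cube polytope_interval)
qed auto

section \<open>Coordinate hyperplanes and the orthogonal projections onto them\<close>

lemma coord_plane_eq: "coord_plane i c = {x. axis i 1 \<bullet> x = c}"
  by (simp add: coord_plane_def inner_axis')

lemma affine_coord_plane: "affine (coord_plane i c)"
  by (simp add: coord_plane_eq affine_hyperplane)

lemma closed_coord_plane: "closed (coord_plane i c)"
  by (simp add: coord_plane_eq closed_hyperplane)

lemma coord_proj_component [simp]: "coord_proj i c z $ j = (if j = i then c else z $ j)"
  by (simp add: coord_proj_def)

lemma coord_proj_in_plane: "coord_proj i c z \<in> coord_plane i c"
  by (simp add: coord_plane_def)

lemma dist_coord_proj: "dist z (coord_proj i c z) = \<bar>z $ i - c\<bar>"
proof -
  have "z - coord_proj i c z = (z $ i - c) *\<^sub>R axis i 1"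
    by (simp add: vec_eq_iff axis_def)
  then show ?thesis
    by (simp add: dist_norm)
qed

text \<open>Every point of the plane has \<open>i\<close>-th coordinate \<open>c\<close>, and a
  component of a vector is bounded by its norm. This makes the map in
  \<open>hyperplane_measure\<close> explicit.\<close>

lemma closest_point_coord_plane: "closest_point (coord_plane i c) z = coord_proj i c z"
proof (rule closest_point_unique[symmetric])
  show "\<forall>y\<in>coord_plane i c. dist z (coord_proj i c z) \<le> dist z y"
  proof
    fix y
    assume "y \<in> coord_plane i c"
    then show "dist z (coord_proj i c z) \<le> dist z y"
      using component_le_norm_cart[of "z - y" i]
      unfolding dist_coord_proj by (simp add: dist_norm coord_plane_def)
  qed
qed (simp_all add: affine_imp_convex affine_coord_plane closed_coord_plane coord_proj_in_plane)

lemma infdist_coord_plane: "infdist z (coord_plane i c) = \<bar>z $ i - c\<bar>"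
  using setdist_closest_point[OF closed_coord_plane, of i c z] coord_proj_in_plane
  by (metis infdist_eq_setdist closest_point_coord_plane dist_coord_proj empty_iff)

text \<open>The box is wider in the \<open>i\<close>th direction, so that its interior meets the hyperplane of the side.\<close>

definition wide_box :: "'n \<Rightarrow> (real^'n) set" where
  "wide_box i = box (\<chi> j. if j = i then - 2 else - 1) (\<chi> j. if j = i then 2 else 1)"

lemma mem_wide_box: "x \<in> wide_box i \<longleftrightarrow> \<bar>x $ i\<bar> < 2 \<and> (\<forall>j. j \<noteq> i \<longrightarrow> \<bar>x $ j\<bar> < 1)"
  unfolding wide_box_def mem_box_cart by (auto simp: abs_less_iff minus_less_iff split: if_splits)

lemma side_eq: "\<bar>c\<bar> < 2 \<Longrightarrow> side i c = wide_box i \<inter> coord_plane i c"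
  by (auto simp: side_def mem_wide_box coord_plane_def)

lemma coord_proj_0_in_side: "coord_proj i c 0 \<in> side i c"
  by (simp add: side_def coord_plane_def)

lemma wide_box_Int_plane: "\<bar>c\<bar> < 2 \<Longrightarrow> wide_box i \<inter> coord_plane i c \<noteq> {}"
  using coord_proj_0_in_side[of i c] side_eq by blast

lemma closure_wide_box:
  "closure (wide_box i) = cbox (\<chi> j. if j = i then - 2 else - 1) (\<chi> j. if j = i then 2 else 1)"
  using wide_box_Int_plane[of 0 i] unfolding wide_box_def by (intro closure_box) auto

text \<open>Closure commutes with this intersection because the plane is affine and meets the open
  convex box.\<close>

lemma closure_side_eq:
  assumes "\<bar>c\<bar> < 2"
  shows "closure (side i c) = closure (wide_box i) \<inter> coord_plane i c"
  unfolding side_eq[OF assms]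
  by (rule convex_affine_closure_Int)
     (use wide_box_Int_plane[OF assms, of i] affine_coord_plane
      in \<open>auto simp: wide_box_def rel_interior_open open_box\<close>)

lemma mem_closure_side:
  assumes "\<bar>c\<bar> < 2"
  shows "x \<in> closure (side i c) \<longleftrightarrow> x $ i = c \<and> (\<forall>j. j \<noteq> i \<longrightarrow> \<bar>x $ j\<bar> \<le> 1)"
  using assms unfolding closure_side_eq[OF assms] closure_wide_box mem_box_cart Int_iff
  by (auto simp: coord_plane_def abs_le_iff minus_le_iff split: if_splits)

text \<open>An open set that meets a plane contains enough of it to span it. The hull is the
  hyperplane underlying \<open>hyperplane_measure (side i c)\<close>.\<close>

lemma affine_hull_side:
  assumes "\<bar>c\<bar> < 2"
  shows "affine hull (side i c) = coord_plane i c"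
proof -
  have "interior (wide_box i) = wide_box i"
    by (simp add: wide_box_def interior_open open_box)
  then have "affine hull (coord_plane i c \<inter> wide_box i) = affine hull (coord_plane i c)"
    using wide_box_Int_plane[OF assms, of i]
    by (intro affine_hull_convex_Int_nonempty_interior affine_imp_convex affine_coord_plane) auto
  then show ?thesis
    by (simp add: side_eq[OF assms] Int_commute affine_hull_eq affine_coord_plane)
qed

lemma open_polytopal_side:
  fixes i :: "'n::finite"
  assumes "\<bar>c\<bar> < 2"
  shows "open_polytopal (int CARD('n) - 1) (side i c)"
  unfolding open_polytopal_def
proof (intro conjI exI)
  have conv: "convex (side i c)"
    unfolding side_eq[OF assms] wide_box_def
    by (intro convex_Int convex_box affine_imp_convex affine_coord_plane)
  show "side i c \<noteq> {}"
    using coord_proj_0_in_side by auto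
  show "connected (side i c)"
    using conv by (rule convex_connected)
  have "aff_dim (coord_plane i c) = int DIM(real^'n) - 1"
    unfolding coord_plane_eq by (subst aff_dim_hyperplane) (auto simp: axis_eq_0_iff)
  then show "aff_dim (side i c) = int CARD('n) - 1"
    using aff_dim_affine_hull[of "side i c"] by (simp add: affine_hull_side[OF assms])
  have int: "interior (wide_box i) = wide_box i"
    by (simp add: wide_box_def interior_open open_box)
  have "rel_interior (side i c) = side i c"
    using wide_box_Int_plane[OF assms, of i] affine_coord_plane[of i c] int
    unfolding side_eq[OF assms]
    by (subst rel_interior_convex_Int_affine) (auto simp: wide_box_def)
  then show "rel_interior (closure (side i c)) = side i c"
    using convex_rel_interior_closure[OF conv] by simp
  have "polytope (closure (side i c))"
    unfolding closure_side_eq[OF assms] closure_wide_box coord_plane_eq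
    by (intro polytope_Int_polyhedron polytope_interval polyhedron_hyperplane)
  then show "\<forall>p\<in>{closure (side i c)}. polytope p"
    by simp
qed auto

section \<open>The sides as a partition of the boundary\<close>

lemma finite_cube_sides: "finite cube_sides"
  by (simp add: cube_sides_def)

lemma cube_sidesE:
  assumes "e \<in> cube_sides"
  obtains i c where "e = side i c" "\<bar>c\<bar> = 1"
  using assms by (fastforce simp: cube_sides_def)

lemma side_subset_frontier: "\<bar>c\<bar> = 1 \<Longrightarrow> side i c \<subseteq> frontier cube"
proof
  fix x
  assume c: "\<bar>c\<bar> = 1" and "x \<in> side i c"
  then have i: "\<bar>x $ i\<bar> = 1" and j: "\<And>j. j \<noteq> i \<Longrightarrow> \<bar>x $ j\<bar> < 1"
    by (auto simp: side_def coord_plane_def)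
  then have "\<bar>x $ j\<bar> \<le> 1" for j
    by (cases "j = i") (auto simp: less_imp_le)
  then show "x \<in> frontier cube"
    using i by (auto simp: frontier_cube mem_cube mem_closure_cube intro!: exI[of _ i])
qed

lemma faces_cube: "faces cube_sides cube = cube_sides"
  using side_subset_frontier by (fastforce simp: faces_def elim: cube_sidesE)

text \<open>A boundary point has some coordinate of absolute value 1, and the index and sign of that
  coordinate name a side whose closure contains the point.\<close>

lemma frontier_cube_sides: "frontier (cube :: (real^'n) set) = \<Union>(closure ` cube_sides)"
proof
  show "frontier (cube :: (real^'n) set) \<subseteq> \<Union>(closure ` cube_sides)"
  proof
    fix x :: "real^'n"
    assume "x \<in> frontier cube"
    then obtain i where i: "\<bar>x $ i\<bar> = 1" and le: "\<And>j. \<bar>x $ j\<bar> \<le> 1"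
      by (force simp: frontier_cube mem_cube mem_closure_cube not_less intro: antisym)
    then have "x \<in> closure (side i (x $ i))"
      by (simp add: mem_closure_side)
    moreover have "side i (x $ i) \<in> cube_sides"
      using i by (fastforce simp: cube_sides_def abs_if split: if_splits)
    ultimately show "x \<in> \<Union>(closure ` cube_sides)"
      by blast
  qed
  show "\<Union>(closure ` cube_sides) \<subseteq> frontier (cube :: (real^'n) set)"
  proof (rule UN_least)
    fix e :: "(real^'n) set"
    assume "e \<in> cube_sides"
    then show "closure e \<subseteq> frontier cube"
      by (elim cube_sidesE) (simp add: closure_minimal frontier_closed side_subset_frontier)
  qed
qed

text \<open>For \<open>i \<noteq> j\<close> the \<open>i\<close>-th coordinate separates the sides:
  its modulus is 1 on the first and less than 1 on the second. For \<open>i = j\<close> it takes the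
  distinct values \<open>c\<close> and \<open>d\<close>.\<close>

lemma disjnt_sides:
  assumes "side i c \<noteq> side j d" "\<bar>c\<bar> = 1" "\<bar>d\<bar> = 1"
  shows "disjnt (side i c) (side j d)"
proof (cases "i = j")
  case False
  then have "\<bar>x $ i\<bar> < 1" if "x \<in> side j d" for x
    using that by (simp add: side_def)
  with assms(2) show ?thesis
    by (force simp: side_def[of i] coord_plane_def disjnt_iff)
qed (use assms(1) in \<open>auto simp: side_def coord_plane_def disjnt_iff\<close>)

text \<open>With a single element, the clause on pairs of distinct elements holds vacuously.\<close>

lemma face_partition_cube: "face_partition {cube :: (real^'n) set} cube_sides"
  unfolding face_partition_def
proof (intro conjI ballI)
  fix e :: "(real^'n) set"
  assume "e \<in> cube_sides"
  then show "open_polytopal (int DIM(real^'n) - 1) e"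
    by (elim cube_sidesE) (simp add: open_polytopal_side)
next
  show "pairwise disjnt (cube_sides :: (real^'n) set set)"
    unfolding pairwise_def by (metis cube_sidesE disjnt_sides)
qed (auto simp: finite_cube_sides faces_cube frontier_cube_sides)

lemma polytopal_partition_cube: "polytopal_partition cube {cube}"
  by (simp add: polytopal_partition_def polytopal_domain_cube)

lemma coefficient_identity:
  assumes "polytopal_partition \<Omega> {\<Omega>}"
  shows "coefficient \<Omega> (\<lambda>x. mat 1)"
  unfolding coefficient_def
proof (intro conjI)
  have "(\<lambda>x. mat 1) ` \<Omega> \<subseteq> {mat 1 :: real^'a^'a}"
    by auto
  then show "bounded ((\<lambda>x. mat 1 :: real^'a^'a) ` \<Omega>)"
    by (rule bounded_subset[rotated]) simp
  show "\<exists>P. polytopal_partition \<Omega> P \<and> (\<forall>D\<in>P. continuous_on D (\<lambda>x. mat 1 :: real^'a^'a))"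
    using assms by (intro exI[of _ "{\<Omega>}"]) simp
  show "\<exists>\<alpha>>0. \<forall>x\<in>\<Omega>. \<forall>\<xi>. \<alpha> * (norm \<xi>)\<^sup>2 \<le> \<xi> \<bullet> (mat 1 *v \<xi> :: real^'a)"
    by (intro exI[of _ 1]) (auto simp: dot_square_norm)
qed (simp add: transpose_mat)

lemma admissible_cube: "1 \<le> k \<Longrightarrow> 0 < \<rho> \<Longrightarrow> admissible cube (\<lambda>x. mat 1) {cube} cube_sides k \<rho>"
  by (simp add: admissible_def polytopal_domain_cube coefficient_identity polytopal_partition_cube
      face_partition_cube)

section \<open>Integrals over the sides\<close>

text \<open>The right cylinder of height 1 with mid-section \<open>side i c\<close>, that is, the
  part of the slab in \<open>hyperplane_measure\<close> that projects into the side.\<close>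

definition side_slab :: "'n \<Rightarrow> real \<Rightarrow> (real^'n) set" where
  "side_slab i c = {z. \<bar>z $ i - c\<bar> \<le> 1/2 \<and> (\<forall>j. j \<noteq> i \<longrightarrow> \<bar>z $ j\<bar> < 1)}"

lemma open_transverse_strip: "open {z :: real^'n. \<forall>j. j \<noteq> i \<longrightarrow> \<bar>z $ j\<bar> < 1}"
proof -
  have "open (\<Inter>j\<in>UNIV - {i}. {z :: real^'n. \<bar>z $ j\<bar> < 1})"
    by (intro open_INT ballI open_Collect_less continuous_intros) simp
  also have "(\<Inter>j\<in>UNIV - {i}. {z :: real^'n. \<bar>z $ j\<bar> < 1}) = {z. \<forall>j. j \<noteq> i \<longrightarrow> \<bar>z $ j\<bar> < 1}"
    by auto
  finally show ?thesis .
qed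

lemma side_slab_borel [measurable]: "side_slab i c \<in> sets (borel :: (real^'n) measure)"
proof -
  have "closed {z :: real^'n. \<bar>z $ i - c\<bar> \<le> 1/2}"
    by (intro closed_Collect_le continuous_intros)
  moreover have "open {z :: real^'n. \<forall>j. j \<noteq> i \<longrightarrow> \<bar>z $ j\<bar> < 1}"
    by (rule open_transverse_strip)
  ultimately show ?thesis
    by (simp add: side_slab_def Collect_conj_eq)
qed

lemma continuous_coord_proj: "continuous_on UNIV (coord_proj i c)"
proof -
  have "continuous_on UNIV (\<lambda>z. if j = i then c else z $ j)" for j
    by (cases "j = i") (auto intro!: continuous_intros)
  then show ?thesis
    unfolding coord_proj_def by (rule continuous_on_vec_lambda)
qed

text \<open>Turns the integral over a side into a Lebesgue integral over the cylinder. The factors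
  may jump off the side, hence the globally continuous representative \<open>h\<close> of their
  product.\<close>

lemma face_inner_side:
  fixes h :: "real^'n \<Rightarrow> real"
  assumes h: "continuous_on UNIV h" and eq: "\<And>x. x \<in> side i c \<Longrightarrow> f x * g x = h x"
    and c: "\<bar>c\<bar> < 2"
  shows "face_inner (side i c) f g =
    (LINT z|lborel. indicator (side_slab i c) z * h (coord_proj i c z))"
proof -
  let ?S = "{z. infdist z (coord_plane i c) \<le> 1/2}"
  let ?p = "coord_proj i c"
  have [measurable]: "h \<in> borel_measurable borel" "?p \<in> borel_measurable borel"
    using h by (simp_all add: borel_measurable_continuous_onI continuous_coord_proj)
  have "closed ?S"
    unfolding infdist_coord_plane by (intro closed_Collect_le continuous_intros)
  then have S [measurable]: "?S \<in> sets borel"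
    by (rule borel_closed)
  have [measurable]: "side i c \<in> sets borel"
  proof -
    have "open (wide_box i)"
      by (simp add: wide_box_def open_box)
    with closed_coord_plane[of i c] show ?thesis
      by (simp add: side_eq[OF c])
  qed
  have "face_inner (side i c) f g =
      (LINT x|hyperplane_measure (side i c). indicator (side i c) x * h x)"
    unfolding face_inner_def set_lebesgue_integral_def
    by (intro Bochner_Integration.integral_cong) (auto simp: eq split: split_indicator)
  \<comment> \<open>Change of variables for the pushforward along the projection.\<close>
  also have "\<dots> = (LINT x|restrict_space lborel ?S. indicator (side i c) (?p x) * h (?p x))"
    unfolding hyperplane_measure_def affine_hull_side[OF c] closest_point_coord_plane
    by (subst integral_distr) (auto intro: measurable_restrict_space1)
  also have "\<dots> = (LINT x|lborel. indicator ?S x * (indicator (side i c) (?p x) * h (?p x)))"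
    by (subst integral_restrict_space) (use S in simp_all)
  also have "\<dots> = (LINT z|lborel. indicator (side_slab i c) z * h (?p z))"
    unfolding infdist_coord_plane
    by (intro Bochner_Integration.integral_cong refl)
       (auto simp: side_slab_def side_def coord_plane_def split: split_indicator)
  finally show ?thesis .
qed

text \<open>The cylinder lies in a compact box, on which the continuous integrand is
  integrable.\<close>

lemma integrable_side_slab:
  fixes h :: "real^'n \<Rightarrow> real"
  assumes "continuous_on UNIV h"
  shows "integrable lborel (\<lambda>z. indicator (side_slab i c) z * h (coord_proj i c z))"
proof -
  let ?K = "cbox (\<chi> j. if j = i then c - 1 else - 1) (\<chi> j. if j = i then c + 1 else 1) :: (real^'n) set"
  have "continuous_on UNIV (\<lambda>z. h (coord_proj i c z))"
    using continuous_on_compose2[OF assms continuous_coord_proj] by simp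
  then have int: "set_integrable lborel ?K (\<lambda>z. h (coord_proj i c z))"
    unfolding set_integrable_def by (intro borel_integrable_compact) (auto intro: continuous_on_subset)
  have sub: "side_slab i c \<subseteq> ?K"
  proof
    fix z :: "real^'n"
    assume z: "z \<in> side_slab i c"
    have "(if j = i then c - 1 else - 1) \<le> z $ j \<and> z $ j \<le> (if j = i then c + 1 else 1)" for j
    proof (cases "j = i")
      case True
      have "\<bar>z $ i - c\<bar> \<le> 1/2"
        using z by (simp add: side_slab_def)
      then have "c - 1 \<le> z $ i \<and> z $ i \<le> c + 1"
        by linarith
      with True show ?thesis
        by simp
    qed (use z in \<open>auto simp: side_slab_def abs_less_iff less_imp_le\<close>)
    then show "z \<in> ?K"
      by (simp add: mem_box_cart)
  qed
  have "set_integrable lborel (side_slab i c) (\<lambda>z. h (coord_proj i c z))"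
    by (rule set_integrable_subset[OF int _ sub]) simp
  then show ?thesis
    by (simp add: set_integrable_def)
qed

text \<open>If the integral were 0, the integrand would vanish almost everywhere, but it is nonzero
  on an open set containing \<open>x\<close>.\<close>

lemma side_integral_pos:
  fixes h :: "real^'n \<Rightarrow> real"
  assumes h: "continuous_on UNIV h" and nonneg: "\<And>x. 0 \<le> h x"
    and x: "x \<in> side i c" "h x \<noteq> 0"
  shows "0 < (LINT z|lborel. indicator (side_slab i c) z * h (coord_proj i c z))" (is "0 < ?I")
proof (rule ccontr)
  let ?g = "\<lambda>z. indicator (side_slab i c) z * h (coord_proj i c z)"
  assume "\<not> 0 < ?I"
  moreover have "0 \<le> ?I"
    by (intro integral_nonneg_AE) (auto simp: nonneg)
  ultimately have "?I = 0"
    by simp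
  then have ae: "AE z in lborel. ?g z = 0"
    using integral_nonneg_eq_0_iff_AE[OF integrable_side_slab[OF h]] nonneg by auto
  \<comment> \<open>The strict bound 1/2, unlike the one in \<open>side_slab\<close>, makes
    \<open>G\<close> open.\<close>
  define G where "G = {z. \<bar>z $ i - c\<bar> < 1/2 \<and> (\<forall>j. j \<noteq> i \<longrightarrow> \<bar>z $ j\<bar> < 1) \<and>
    h (coord_proj i c z) \<noteq> 0}"
  have "open G"
  proof -
    have "continuous_on UNIV (\<lambda>z. h (coord_proj i c z))"
      using continuous_on_compose2[OF h continuous_coord_proj] by simp
    then show ?thesis
      unfolding G_def
      by (intro open_Collect_conj open_transverse_strip open_Collect_less open_Collect_neq
          continuous_intros)
  qed
  moreover have "x \<in> G"
  proof -
    have "coord_proj i c x = x"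
      using x by (auto simp: vec_eq_iff side_def coord_plane_def)
    then show ?thesis
      using x by (auto simp: G_def side_def coord_plane_def)
  qed
  moreover have "negligible G"
  proof -
    have "AE z in lborel. z \<notin> G"
      using ae by eventually_elim (auto simp: G_def side_slab_def split: split_indicator_asm)
    then have "G \<in> null_sets lborel"
      using \<open>open G\<close> by (simp add: AE_iff_null_sets)
    then show ?thesis
      by (simp add: negligible_iff_null_sets null_sets_completionI)
  qed
  ultimately show False
    using open_not_negligible by blast
qed

section \<open>Reflections in the coordinate hyperplanes\<close>

definition flip :: "'n \<Rightarrow> real^'n \<Rightarrow> real^'n" where
  "flip m x = (\<chi> j. if j = m then - x $ j else x $ j)"

lemma flip_component [simp]: "flip m x $ j = (if j = m then - x $ j else x $ j)"
  by (simp add: flip_def)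

lemma continuous_flip: "continuous_on UNIV (flip m :: real^'n \<Rightarrow> real^'n)"
proof -
  have "continuous_on UNIV (\<lambda>x :: real^'n. if j = m then - x $ j else x $ j)" for j
    by (cases "j = m") (simp_all add: continuous_on_minus continuous_on_component)
  then show ?thesis
    unfolding flip_def by (rule continuous_on_vec_lambda)
qed

text \<open>The reflection is diagonal with entries 1 and -1, so its determinant has modulus 1 and
  Lebesgue measure is preserved.\<close>

lemma distr_flip: "distr lborel borel (flip m) = (lborel :: (real^'n) measure)"
proof -
  let ?c = "\<lambda>b :: real^'n. if b = axis m 1 then - 1 else (1::real)"
  have "(\<lambda>x. 0 + (\<Sum>j\<in>Basis. (?c j * (x \<bullet> j)) *\<^sub>R j)) = flip m"
  proof
    fix x :: "real^'n"
    have "(\<Sum>j\<in>Basis. (?c j * (x \<bullet> j)) *\<^sub>R j) \<bullet> b = flip m x \<bullet> b" if b: "b \<in> Basis" for b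
    proof -
      obtain l where l: "b = axis l 1"
        using b by (auto simp: Basis_vec_def)
      show ?thesis
        by (simp add: inner_sum_left_Basis[OF b]) (simp add: l inner_axis axis_eq_axis)
    qed
    then show "0 + (\<Sum>j\<in>Basis. (?c j * (x \<bullet> j)) *\<^sub>R j) = flip m x"
      unfolding add_0 by (rule euclidean_eqI)
  qed
  moreover have "(\<Prod>j\<in>Basis. \<bar>?c j\<bar>) = 1"
    by (intro prod.neutral) auto
  ultimately show ?thesis
    using lborel_affine_euclidean[of ?c 0] by (simp add: density_1)
qed

text \<open>For \<open>m \<noteq> i\<close> the reflection commutes with the projection and
  preserves the cylinder, so the integral equals its own negative.\<close>

lemma side_integral_odd:
  fixes h :: "real^'n \<Rightarrow> real"
  assumes h: "continuous_on UNIV h" and odd: "\<And>x. h (flip m x) = - h x" and m: "m \<noteq> i"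
  shows "(LINT z|lborel. indicator (side_slab i c) z * h (coord_proj i c z)) = 0"
proof -
  let ?g = "\<lambda>z. indicator (side_slab i c) z * h (coord_proj i c z)"
  have [measurable]: "h \<in> borel_measurable borel" "coord_proj i c \<in> borel_measurable borel"
    "flip m \<in> borel_measurable borel"
    using h
    by (simp_all add: borel_measurable_continuous_onI continuous_coord_proj continuous_flip)
  have "?g (flip m z) = - ?g z" for z
  proof -
    have "coord_proj i c (flip m z) = flip m (coord_proj i c z)"
      using m by (auto simp: vec_eq_iff)
    moreover have "flip m z \<in> side_slab i c \<longleftrightarrow> z \<in> side_slab i c"
      using m by (auto simp: side_slab_def)
    ultimately show ?thesis
      by (simp add: odd indicator_def)
  qed
  then have flipped: "(LINT z|lborel. ?g (flip m z)) = - (LINT z|lborel. ?g z)"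
    by simp
  have "(LINT z|lborel. ?g z) = (LINT z|distr lborel borel (flip m). ?g z)"
    by (simp only: distr_flip)
  also have "\<dots> = (LINT z|lborel. ?g (flip m z))"
    by (rule integral_distr) auto
  finally show ?thesis
    unfolding flipped by linarith
qed

section \<open>Piecewise constants and the product of two coordinates\<close>

text \<open>Each exponent is at most \<open>k\<close>. Finiteness matters because a sum over an
  infinite index set would be 0 by convention.\<close>

lemma finite_multi_indices: "finite {\<alpha> :: 'n::finite \<Rightarrow> nat. (\<Sum>i\<in>UNIV. \<alpha> i) \<le> k}"
proof (rule finite_subset)
  show "finite (PiE UNIV (\<lambda>_ :: 'n. {..k}))"
    by (intro finite_PiE) auto
  show "{\<alpha> :: 'n \<Rightarrow> nat. (\<Sum>i\<in>UNIV. \<alpha> i) \<le> k} \<subseteq> PiE UNIV (\<lambda>_. {..k})"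
  proof
    fix \<alpha> :: "'n \<Rightarrow> nat"
    assume "\<alpha> \<in> {\<alpha>. (\<Sum>i\<in>UNIV. \<alpha> i) \<le> k}"
    moreover have "\<alpha> i \<le> (\<Sum>i\<in>UNIV. \<alpha> i)" for i
      by (rule member_le_sum) auto
    ultimately show "\<alpha> \<in> PiE UNIV (\<lambda>_. {..k})"
      by (fastforce simp: PiE_UNIV_domain intro: le_trans)
  qed
qed

lemma monomial_in_poly_fun:
  assumes "(\<Sum>i\<in>UNIV. \<beta> i) \<le> k"
  shows "(\<lambda>x :: real^'n. \<Prod>i\<in>UNIV. (x $ i) ^ \<beta> i) \<in> poly_fun k"
  unfolding poly_fun_def
proof (intro CollectI exI[of _ "\<lambda>\<alpha>. if \<alpha> = \<beta> then 1 else 0"] allI)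
  fix x :: "real^'n"
  show "(\<Prod>i\<in>UNIV. (x $ i) ^ \<beta> i) =
    (\<Sum>\<alpha> | (\<Sum>i\<in>UNIV. \<alpha> i) \<le> k. (if \<alpha> = \<beta> then 1 else 0) * (\<Prod>i\<in>UNIV. (x $ i) ^ \<alpha> i))"
    using assms by (subst sum.mono_neutral_right[of _ "{\<beta>}"]) (auto simp: finite_multi_indices)
qed

lemma zero_in_poly_fun: "(\<lambda>x. 0) \<in> poly_fun k"
  unfolding poly_fun_def by (intro CollectI exI[of _ "\<lambda>\<alpha>. 0"]) simp

lemma poly_fun_0_const:
  assumes "p \<in> poly_fun 0"
  obtains m where "\<And>x :: real^'n. p x = m"
proof -
  obtain c where c: "\<And>x. p x = (\<Sum>\<alpha> | (\<Sum>i\<in>UNIV. \<alpha> i) \<le> 0. c \<alpha> * (\<Prod>i\<in>UNIV. (x $ i) ^ \<alpha> i))"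
    using assms unfolding poly_fun_def by blast
  have "{\<alpha> :: 'n \<Rightarrow> nat. (\<Sum>i\<in>UNIV. \<alpha> i) \<le> 0} = {\<lambda>i. 0}"
    by (auto simp: fun_eq_iff)
  then have "p x = c (\<lambda>i. 0)" for x
    by (simp add: c)
  then show thesis
    by (rule that)
qed

lemma zero_in_pw_poly: "(\<lambda>x. 0) \<in> pw_poly k S"
  using zero_in_poly_fun by (fastforce simp: pw_poly_def)

lemma pw_poly_0_const:
  assumes "w \<in> pw_poly 0 {D}"
  obtains m where "w = (\<lambda>x. if x \<in> D then m else 0)"
proof -
  obtain p where p: "p \<in> poly_fun 0" "\<And>x. x \<in> D \<Longrightarrow> w x = p x"
    and 0: "\<And>x. x \<notin> D \<Longrightarrow> w x = 0"
    using assms by (auto simp: pw_poly_def)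
  obtain m where "\<And>x. p x = m"
    using poly_fun_0_const[OF p(1)] by blast
  with p 0 have "w = (\<lambda>x. if x \<in> D then m else 0)"
    by auto
  then show thesis
    by (rule that)
qed

lemma pw_poly_vec_0_const:
  assumes "v \<in> pw_poly_vec 0 {D}"
  obtains m where "v = (\<lambda>x. if x \<in> D then m else 0)"
proof -
  have "\<exists>m. (\<lambda>x. v x $ i) = (\<lambda>x. if x \<in> D then m else 0)" for i
    using assms pw_poly_0_const[of "\<lambda>x. v x $ i" D] unfolding pw_poly_vec_def by blast
  then obtain m where m: "\<And>i. (\<lambda>x. v x $ i) = (\<lambda>x. if x \<in> D then m i else 0)"
    by metis
  have "v = (\<lambda>x. if x \<in> D then (\<chi> i. m i) else 0)"
  proof
    fix x
    show "v x = (if x \<in> D then (\<chi> i. m i) else 0)"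
      using fun_cong[OF m, of x] by (simp add: vec_eq_iff)
  qed
  then show thesis
    by (rule that)
qed

lemma divergence_const:
  assumes "open T" "x \<in> T"
  shows "divergence (\<lambda>x. if x \<in> T then m else 0) x = 0"
proof -
  have "((\<lambda>x. if x \<in> T then m else 0) has_derivative (\<lambda>h. 0)) (at x)"
    by (rule has_derivative_transform_within_open[OF has_derivative_const[of m] assms]) simp
  then show ?thesis
    by (simp add: divergence_def flip: frechet_derivative_at)
qed

text \<open>For \<open>r = 0\<close> this removes the volume term from the definition of the weak
  gradient and from the first HDG equation.\<close>

lemma L2_inner_divergence_const:
  assumes "open T" "v \<in> pw_poly_vec 0 {T}"
  shows "L2_inner T u (divergence v) = 0"
proof -
  obtain m where v: "v = (\<lambda>x. if x \<in> T then m else 0)"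
    using assms(2) by (rule pw_poly_vec_0_const)
  have "L2_inner T u (divergence v) = (LINT x|lebesgue_on T. 0)"
    unfolding L2_inner_def v
    by (intro Bochner_Integration.integral_cong) (simp_all add: divergence_const[OF assms(1)])
  then show ?thesis
    by simp
qed

text \<open>If \<open>v\<close> equals \<open>m\<close> on \<open>T\<close>, the inner product is
  \<open>m \<bullet> m\<close> times the measure of \<open>T\<close>, which is positive. This yields
  uniqueness of the weak gradient and forces the HDG flux to vanish.\<close>

lemma pw_poly_vec_0_eq_0:
  assumes T: "open T" "bounded T" "T \<noteq> {}" and v: "v \<in> pw_poly_vec 0 {T}" and 0: "L2_inner T v v = 0"
  shows "v = (\<lambda>x. 0)"
proof -
  obtain m where m: "v = (\<lambda>x. if x \<in> T then m else 0)"
    using v by (rule pw_poly_vec_0_const)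
  have lm: "T \<in> lmeasurable"
    using T by (simp add: lmeasurable_open)
  have "L2_inner T v v = (LINT x|lebesgue_on T. m \<bullet> m)"
    unfolding L2_inner_def m by (intro Bochner_Integration.integral_cong) simp_all
  also have "\<dots> = measure lebesgue T * (m \<bullet> m)"
    using lm by (simp add: measure_restrict_space fmeasurableD)
  finally have "measure lebesgue T * (m \<bullet> m) = 0"
    using 0 by simp
  moreover have "measure lebesgue T \<noteq> 0"
    using open_not_negligible[OF T(1,3)] negligible_iff_measure lm by blast
  ultimately show ?thesis
    by (simp add: m fun_eq_iff)
qed

lemma L2_inner_zero_left: "L2_inner T (\<lambda>x. 0) g = 0"
  by (simp add: L2_inner_def)

lemma face_inner_zero_left: "face_inner e (\<lambda>x. 0) g = 0"
  by (simp add: face_inner_def)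

lemma faces_inner_zero_left: "faces_inner F (\<lambda>x. 0) g = 0"
  by (simp add: faces_inner_def face_inner_zero_left)

text \<open>A frontier point of an open set is a limit point of it, so the limit from inside is
  unique. Values of \<open>w\<close> off \<open>T\<close>, such as a cutoff to 0, do not
  enter.\<close>

lemma trace_from_eq:
  assumes "open T" "x \<in> frontier T" "continuous_on UNIV h" "\<And>y. y \<in> T \<Longrightarrow> w y = h y"
  shows "trace_from T w x = h x"
proof -
  have "x islimpt T"
    using assms(1,2) by (auto simp: frontier_def interior_open closure_def)
  then have "at x within T \<noteq> bot"
    by (simp add: trivial_limit_within)
  moreover have "(h \<longlongrightarrow> h x) (at x within T)"
    using assms(3) by (meson UNIV_I continuous_on_def subset_UNIV tendsto_within_subset)
  then have "(w \<longlongrightarrow> h x) (at x within T)"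
    by (rule Lim_transform_eventually) (simp add: eventually_at_filter assms(4))
  ultimately show ?thesis
    unfolding trace_from_def by (rule tendsto_Lim)
qed

section \<open>The product of two coordinates and its traces\<close>

definition coord_prod :: "'n \<Rightarrow> 'n \<Rightarrow> real^'n \<Rightarrow> real" where
  "coord_prod p q x = x $ p * x $ q"

text \<open>Cut off outside the cube because members of \<open>pw_poly\<close> vanish there.\<close>

definition cube_prod :: "'n \<Rightarrow> 'n \<Rightarrow> real^'n \<Rightarrow> real" where
  "cube_prod p q x = (if x \<in> cube then coord_prod p q x else 0)"

lemma continuous_coord_prod: "continuous_on UNIV (coord_prod p q)"
  unfolding coord_prod_def by (intro continuous_intros)

lemma coord_prod_flip:
  assumes "p \<noteq> q" "m = p \<or> m = q"
  shows "coord_prod p q (flip m x) = - coord_prod p q x"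
  using assms by (auto simp: coord_prod_def)

lemma coord_prod_in_poly_fun:
  assumes "p \<noteq> q"
  shows "coord_prod p q \<in> poly_fun 2"
proof -
  \<comment> \<open>As \<open>p \<noteq> q\<close>, this multi-index has total degree 2.\<close>
  let ?\<beta> = "\<lambda>i. if i = p \<or> i = q then 1 else (0::nat)"
  have "(\<Sum>i\<in>UNIV. ?\<beta> i) = (\<Sum>i\<in>{p, q}. 1)"
    by (intro sum.mono_neutral_cong_right) auto
  then have "(\<lambda>x. \<Prod>i\<in>UNIV. (x $ i) ^ ?\<beta> i) \<in> poly_fun 2"
    using assms by (intro monomial_in_poly_fun) simp
  moreover have "(\<Prod>i\<in>UNIV. (x $ i) ^ ?\<beta> i) = coord_prod p q x" for x :: "real^'a"
  proof -
    have "(\<Prod>i\<in>UNIV. (x $ i) ^ ?\<beta> i) = (\<Prod>i\<in>{p, q}. x $ i)"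
      by (intro prod.mono_neutral_cong_right) auto
    then show ?thesis
      using assms by (simp add: coord_prod_def)
  qed
  ultimately show ?thesis
    by simp
qed

lemma cube_prod_in_W_h: "p \<noteq> q \<Longrightarrow> cube_prod p q \<in> W_h {cube} 2"
  using coord_prod_in_poly_fun by (fastforce simp: pw_poly_def cube_prod_def)

lemma trace_cube_prod:
  assumes "x \<in> side i c" "\<bar>c\<bar> = 1"
  shows "trace_from cube (cube_prod p q) x = coord_prod p q x"
  using assms side_subset_frontier[of c i]
  by (intro trace_from_eq open_cube continuous_coord_prod) (auto simp: cube_prod_def)

lemma side_integral_coord_prod:
  assumes "p \<noteq> q"
  shows "(LINT z|lborel. indicator (side_slab i c) z * (m * coord_prod p q (coord_proj i c z))) = 0"
proof -
  \<comment> \<open>At most one of \<open>p\<close> and \<open>q\<close> is the normal direction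
    \<open>i\<close>; reflecting in the other one preserves the side and changes the sign of the
    product.\<close>
  obtain l where l: "l = p \<or> l = q" "l \<noteq> i"
    using assms by metis
  show ?thesis
    by (rule side_integral_odd[OF _ _ l(2), of "\<lambda>x. m * coord_prod p q x"])
       (auto intro!: continuous_intros continuous_coord_prod simp: coord_prod_flip[OF assms l(1)])
qed

section \<open>The product of two coordinates in both methods\<close>

lemma bounded_cube: "bounded (cube :: (real^'n) set)"
  by (simp add: cube_def bounded_box)

lemma cube_nonempty: "cube \<noteq> {}"
  using zero_in_cube by auto

text \<open>The right-hand side of the defining equation is 0 for constant test fields. Uniqueness
  follows by testing a candidate \<open>g\<close> with itself.\<close>

lemma weak_grad_eq_0: "weak_grad {cube} E 0 (w, \<lambda>x. 0) = (\<lambda>x. 0)"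
  unfolding weak_grad_def
proof (rule the_equality)
  show "(\<lambda>x. 0) \<in> V_h {cube} 0 \<and> (\<forall>T\<in>{cube}. \<forall>v\<in>pw_poly_vec 0 {T}. L2_inner T (\<lambda>x. 0) v =
    - L2_inner T (fst (w, \<lambda>x. 0)) (divergence v) +
    faces_inner (faces E T) (snd (w, \<lambda>x. 0)) (\<lambda>x. trace_from T v x \<bullet> outward_normal T x))"
    by (simp add: pw_poly_vec_def[of 0 "{cube}"] zero_in_pw_poly L2_inner_zero_left
        faces_inner_zero_left L2_inner_divergence_const[OF open_cube])
next
  fix g
  assume g: "g \<in> V_h {cube} 0 \<and> (\<forall>T\<in>{cube}. \<forall>v\<in>pw_poly_vec 0 {T}. L2_inner T g v =
    - L2_inner T (fst (w, \<lambda>x. 0)) (divergence v) +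
    faces_inner (faces E T) (snd (w, \<lambda>x. 0)) (\<lambda>x. trace_from T v x \<bullet> outward_normal T x))"
  then have "L2_inner cube g g = 0"
    by (simp add: faces_inner_zero_left L2_inner_divergence_const[OF open_cube])
  with g show "g = (\<lambda>x. 0)"
    using pw_poly_vec_0_eq_0[OF open_cube bounded_cube cube_nonempty] by blast
qed

text \<open>Projection onto constants takes the mean, which is 0 here. The description operator also
  needs uniqueness, obtained by testing a candidate with itself.\<close>

lemma face_proj_cube_prod:
  assumes pq: "p \<noteq> q" and c: "\<bar>c\<bar> = 1"
  shows "face_proj 0 (side i c) (trace_from cube (cube_prod p q)) = (\<lambda>x. 0)"
  unfolding face_proj_def
proof (rule the_equality)
  let ?e = "side i c"
  let ?g = "trace_from cube (cube_prod p q)"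
  \<comment> \<open>This form covers both integrands below: \<open>a = 0\<close>,
    \<open>b = m\<close> for existence and \<open>a = m * m\<close>, \<open>b = m\<close> for
    uniqueness.\<close>
  have cont: "continuous_on UNIV (\<lambda>x. a - b * coord_prod p q x)" for a b :: real
    by (intro continuous_intros continuous_coord_prod)
  have c2: "\<bar>c\<bar> < 2"
    using c by simp
  note int = face_inner_side[OF cont _ c2]
  show "(\<lambda>x. 0) \<in> pw_poly 0 {?e} \<and> (\<forall>w\<in>pw_poly 0 {?e}. face_inner ?e (\<lambda>x. 0 - ?g x) w = 0)"
  proof (intro conjI zero_in_pw_poly ballI)
    fix w
    assume "w \<in> pw_poly 0 {?e}"
    then obtain m where w: "w = (\<lambda>x. if x \<in> ?e then m else 0)"
      by (rule pw_poly_0_const)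
    have "face_inner ?e (\<lambda>x. 0 - ?g x) w = (LINT z|lborel. indicator (side_slab i c) z *
        (0 - m * coord_prod p q (coord_proj i c z)))"
      by (rule int) (simp add: w trace_cube_prod[OF _ c])
    then show "face_inner ?e (\<lambda>x. 0 - ?g x) w = 0"
      using side_integral_coord_prod[OF pq, of i c "- m"] by simp
  qed
  fix \<mu>
  assume \<mu>: "\<mu> \<in> pw_poly 0 {?e} \<and> (\<forall>w\<in>pw_poly 0 {?e}. face_inner ?e (\<lambda>x. \<mu> x - ?g x) w = 0)"
  then obtain m where m: "\<mu> = (\<lambda>x. if x \<in> ?e then m else 0)"
    using pw_poly_0_const by blast
  have int1: "integrable lborel (\<lambda>z. indicator (side_slab i c) z * m\<^sup>2)"
    using integrable_side_slab[of "\<lambda>x. m\<^sup>2" i c] by simp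
  have int2: "integrable lborel
      (\<lambda>z. indicator (side_slab i c) z * (m * coord_prod p q (coord_proj i c z)))"
    by (rule integrable_side_slab[of "\<lambda>x. m * coord_prod p q x"])
       (intro continuous_intros continuous_coord_prod)
  have "0 = face_inner ?e (\<lambda>x. \<mu> x - ?g x) \<mu>"
    using \<mu> by simp
  also have "\<dots> = (LINT z|lborel. indicator (side_slab i c) z *
      (m\<^sup>2 - m * coord_prod p q (coord_proj i c z)))"
    by (rule int) (simp add: m trace_cube_prod[OF _ c] algebra_simps power2_eq_square)
  also have "\<dots> = (LINT z|lborel. indicator (side_slab i c) z * m\<^sup>2)"
    unfolding right_diff_distrib Bochner_Integration.integral_diff[OF int1 int2]
    using side_integral_coord_prod[OF pq, of i c m] by simp
  \<comment> \<open>Otherwise the integral of this positive constant over the side would be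
    positive; the centre of the side serves as the witness.\<close>
  finally have "m\<^sup>2 = 0"
    using side_integral_pos[of "\<lambda>x. m\<^sup>2", OF _ _ coord_proj_0_in_side[of i c]]
    by (force simp: continuous_on_const)
  then show "\<mu> = (\<lambda>x. 0)"
    by (simp add: m fun_eq_iff)
qed

text \<open>Every term of the equation vanishes: the weak gradient is 0 whatever \<open>a\<close>
  is, and so is the first factor of the stabilization.\<close>

lemma cube_prod_wg_solution:
  assumes "p \<noteq> q"
  shows "(cube_prod p q, \<lambda>x. 0) \<in> wg_solutions cube a {cube} cube_sides 2 0 0 \<rho> (\<lambda>x. 0)"
proof -
  have "Q_b cube_sides 0 (trace_from cube (cube_prod p q)) = (\<lambda>x. 0)"
    unfolding Q_b_def
    by (intro ext sum.neutral ballI) (auto elim!: cube_sidesE simp: face_proj_cube_prod[OF assms])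
  then have "s_p {cube} cube_sides 0 \<rho> (cube_prod p q, \<lambda>x. 0) v = 0" for v
    by (simp add: s_p_def faces_inner_zero_left)
  moreover have "(cube_prod p q, \<lambda>x. 0) \<in> W_h0 cube {cube} cube_sides 2 0"
    using assms by (simp add: W_h0_def M_h0_def cube_prod_in_W_h zero_in_pw_poly)
  ultimately show ?thesis
    by (simp add: wg_solutions_def weak_grad_eq_0 L2_inner_zero_left)
qed

text \<open>Keeps the factor \<open>\<rho> / diameter cube\<close> positive; division by 0 would
  give 0.\<close>

lemma diameter_cube_pos: "0 < diameter (cube :: (real^'n) set)"
proof -
  have "(\<chi> j. 1/2) \<in> (cube :: (real^'n) set)"
    by (simp add: mem_cube)
  then have "dist 0 ((\<chi> j. 1/2) :: real ^ 'n) \<le> diameter (cube :: (real^'n) set)"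
    by (rule diameter_bounded_bound[OF bounded_cube zero_in_cube])
  moreover have "0 < dist 0 ((\<chi> j. 1/2) :: real ^ 'n)"
    by (simp add: vec_eq_iff)
  ultimately show ?thesis
    by linarith
qed

lemma matrix_inv_mat_1: "matrix_inv (mat 1 :: real^'n^'n) = mat 1"
  unfolding matrix_inv_def by (rule some_equality) auto

text \<open>No projection acts on the trace, so the integrand is a positive multiple of the square
  of the product of coordinates.\<close>

lemma flux_cube_prod_pos:
  assumes c: "\<bar>c\<bar> = 1" and \<rho>: "0 < \<rho>"
  shows "0 < face_inner (side i c) (num_flux \<rho> (\<lambda>x. 0) (cube_prod p q) (\<lambda>x. 0) cube)
    (trace_from cube (cube_prod p q))"
proof -
  let ?h = "\<lambda>x :: real^'a. \<rho> / diameter (cube :: (real^'a) set) * (coord_prod p q x)\<^sup>2"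
  \<comment> \<open>All coordinates of this point of the side are nonzero: \<open>c\<close> in
    position \<open>i\<close> and 1/2 elsewhere.\<close>
  let ?x = "coord_proj i c (\<chi> j. 1/2)"
  have cont: "continuous_on UNIV ?h"
    by (intro continuous_intros continuous_coord_prod)
  have "num_flux \<rho> (\<lambda>x. 0) (cube_prod p q) (\<lambda>x. 0) cube x * trace_from cube (cube_prod p q) x = ?h x"
    if x: "x \<in> side i c" for x
  proof -
    have "trace_from cube (\<lambda>x. 0 :: real^'a) x = 0"
      using side_subset_frontier[OF c, of i] x
      by (intro trace_from_eq[of _ _ "\<lambda>x. 0"] open_cube) auto
    then show ?thesis
      by (simp add: num_flux_def trace_cube_prod[OF x c] power2_eq_square)
  qed
  then have "face_inner (side i c) (num_flux \<rho> (\<lambda>x. 0) (cube_prod p q) (\<lambda>x. 0) cube)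
      (trace_from cube (cube_prod p q)) =
    (LINT z|lborel. indicator (side_slab i c) z * ?h (coord_proj i c z))"
    using c by (intro face_inner_side[OF cont]) auto
  also have "\<dots> > 0"
  proof (rule side_integral_pos[OF cont])
    show "?x \<in> side i c"
      by (simp add: side_def coord_plane_def)
    show "?h ?x \<noteq> 0"
      using c \<rho> diameter_cube_pos[where 'n = 'a] by (auto simp: coord_prod_def)
  qed (use \<rho> diameter_cube_pos[where 'n = 'a] in \<open>simp add: less_imp_le\<close>)
  finally show ?thesis .
qed

lemma cube_prod_not_hdg_solution:
  fixes p q :: "'n::finite"
  assumes pq: "p \<noteq> q" and \<rho>: "0 < \<rho>"
  shows "(cube_prod p q, \<lambda>x. 0) \<notin>
    hdg_solutions cube (\<lambda>x. mat 1) {cube} cube_sides 2 0 0 \<rho> (\<lambda>x. 0)"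
proof
  let ?u = "cube_prod p q"
  assume "(?u, \<lambda>x. 0) \<in> hdg_solutions cube (\<lambda>x. mat 1) {cube} cube_sides 2 0 0 \<rho> (\<lambda>x. 0)"
  then obtain v where v: "hdg_solves cube (\<lambda>x. mat 1) {cube} cube_sides 2 0 0 \<rho> (\<lambda>x. 0) v ?u (\<lambda>x. 0)"
    by (auto simp: hdg_solutions_def)
  then have vV: "v \<in> V_h {cube} 0"
    by (simp add: hdg_solves_def)
  \<comment> \<open>The first HDG equation, tested with the flux unknown \<open>v\<close>
    itself.\<close>
  with v have "L2_inner cube v v = 0"
    by (simp add: hdg_solves_def matrix_inv_mat_1 faces_inner_zero_left
        L2_inner_divergence_const[OF open_cube])
  then have "v = (\<lambda>x. 0)"
    using pw_poly_vec_0_eq_0[OF open_cube bounded_cube cube_nonempty vV] by blast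
  \<comment> \<open>The second HDG equation, tested with \<open>?u\<close>; the gradient term and
    the data are 0.\<close>
  with v have "faces_inner cube_sides (num_flux \<rho> (\<lambda>x. 0) ?u (\<lambda>x. 0) cube) (trace_from cube ?u) = 0"
    using cube_prod_in_W_h[OF pq]
    by (simp add: hdg_solves_def L2_inner_zero_left faces_cube)
  moreover have "0 < faces_inner cube_sides (num_flux \<rho> (\<lambda>x. 0) ?u (\<lambda>x. 0) cube) (trace_from cube ?u)"
    unfolding faces_inner_def
  proof (rule sum_pos[OF finite_cube_sides])
    show "cube_sides \<noteq> ({} :: (real^'n) set set)"
      by (simp add: cube_sides_def)
  qed (auto elim!: cube_sidesE intro!: flux_cube_prod_pos \<rho>)
  ultimately show False
    by simp
qed

theorem proposition9p1:
  assumes "CARD('n::finite) = 2 \<or> CARD('n) = 3"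
  shows "\<not> (\<forall>(\<Omega> :: (real^'n) set) a Th E k s r \<rho>.
              admissible \<Omega> a Th E k \<rho> \<longrightarrow> methods_equivalent \<Omega> a Th E k s r \<rho>)"
proof
  assume eq: "\<forall>(\<Omega> :: (real^'n) set) a Th E k s r \<rho>.
    admissible \<Omega> a Th E k \<rho> \<longrightarrow> methods_equivalent \<Omega> a Th E k s r \<rho>"
  \<comment> \<open>Dimension at least 2 supplies two distinct coordinates.\<close>
  have "\<not> card (UNIV :: 'n set) \<le> Suc 0"
    using assms by auto
  then obtain p q :: 'n where pq: "p \<noteq> q"
    by (auto simp: card_le_Suc0_iff_eq)
  have "admissible (cube :: (real^'n) set) (\<lambda>x. mat 1) {cube} cube_sides 2 1"
    by (rule admissible_cube) auto
  \<comment> \<open>The numerals stand for \<open>k = 2\<close>, \<open>s = 0\<close>,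
    \<open>r = 0\<close> and \<open>\<rho> = 1\<close>.\<close>
  with eq have "methods_equivalent (cube :: (real^'n) set) (\<lambda>x. mat 1) {cube} cube_sides 2 0 0 1"
    by blast
  moreover have "L2_fun (cube :: (real^'n) set) (\<lambda>x. 0)"
    by (simp add: L2_fun_def)
  ultimately have "hdg_solutions (cube :: (real^'n) set) (\<lambda>x. mat 1) {cube} cube_sides 2 0 0 1 (\<lambda>x. 0) =
      wg_solutions cube (\<lambda>x. mat 1) {cube} cube_sides 2 0 0 1 (\<lambda>x. 0)"
    unfolding methods_equivalent_def by blast
  then show False
    using cube_prod_wg_solution[OF pq] cube_prod_not_hdg_solution[OF pq zero_less_one] by blast
qed

end
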